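(* Let $\mathcal{L}=\{R\}$ with $R$ a binary relation symbol, let $I=\mathbb{N}$, let $M_i=G_{q_i}$ be the Paley graph on $q_i$ vertices, where $(q_i)_{i\in\mathbb{N}}$ is the sequence of primes congruent to $1$ modulo $4$, let $D$ be a non-principal ultrafilter on $I$, and let $\mathcal{M}:=\prod_D M_i$. Let $x,y$ be single variables. Let $\mu\in\mathfrak{M}_x(\mathcal{M})$ be the pseudo-finite counting measure, i.e. $\mu=\lim_D\mu_i$ where for each $\varphi(x)\in\mathcal{L}_x(M_i)$, $\mu_i(\varphi(x))=\frac{|\{a\in M_i: M_i\models\varphi(a)\}|}{|M_i|}$. Then: (1) The measure $\mu$ is $R$-definable, and in particular $F^{R}_{\mu,\mathcal{M}}$ is the constant function with value $1/2$. (2) For any measure $\nu\in\mathfrak{M}_x(\mathcal{M})$ such that $F^{R}_{\nu,\mathcal{M}}$ is a constant function not equal to $1/2$, $\nu$ is not pseudo-finite (with respect to the family $(M_i)_{i\in I}$ and the ultrafilter $D$). In particular, any unfairly weighted coin-flipping measure on $\mathcal{M}$ is not pseudo-finite with respect to $(M_i)_{i\in I}$ and $D$.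
   Context: Paley graphs: for a prime $q\equiv 1\pmod 4$, $G_q=(\mathbb{F}_q;R)$, where $\mathbb{F}_q$ is the field with $q$ elements and $G_q\models R(a,b)$ iff $a\neq b$ and there is $z\in\mathbb{F}_q$ with $z^2=a-b$. It is known that $\prod_D G_{q_i}$ is a model of the theory of the random graph for every non-principal $D$. For an $\mathcal{L}$-structure $M$, $\mathcal{L}_x(M)$ is the collection of $\mathcal{L}$-formulas with parameters from $M$ and free variable $x$ (modulo equivalence in $M$), and $\mathfrak{M}_x(M)$ is the space of Keisler measures over $M$, i.e. finitely additive probability measures on $\mathcal{L}_x(M)$. For $p\in S_x(M)$, $\delta_p$ is the Dirac measure at $p$. Let $\mathrm{conv}_x(M)=\{\sum_{i=1}^n r_i\delta_{\mathrm{tp}(a_i/M)}: n\ge 1,\ a_i\in M^x,\ r_i>0,\ \sum_{i=1}^n r_i=1\}$. Given $\mu_i\in\mathfrak{M}_x(M_i)$, the ultralimit $\lim_D\mu_i\in\mathfrak{M}_x(\mathcal{M})$ is the measure with $(\lim_D\mu_i)(\varphi(x,\mathbf{b}))=\lim_D\mu_i(\varphi(x,\mathbf{b}(i)))$ for all $\varphi(x,\mathbf{b})\in\mathcal{L}_x(\mathcal{M})$, where $(\mathbf{b}(i))_{i\in I}$ represents $\mathbf{b}$. A measure $\nu\in\mathfrak{M}_x(\mathcal{M})$ is pseudo-finite (with respect to $(M_i)_{i\in I}$ and $D$) if $\nu=\lim_D\nu_i$ for some $\nu_i\in\mathrm{conv}_x(M_i)$, $i\in I$. For a formula $\varphi(x,y)$,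 a measure $\nu\in\mathfrak{M}_x(M)$ is $\varphi$-definable if there is a (necessarily unique) continuous function $F^{\varphi}_{\nu,M}:S_y(M)\to[0,1]$ with $F^{\varphi}_{\nu,M}(\mathrm{tp}(b/M))=\nu(\varphi(x,b))$ for all $b\in M^y$. Here $\varphi(x,y)$ is $R(x,y)$. For a model $M$ of the random graph, an unfairly weighted coin-flipping measure is a measure $\nu_p\in\mathfrak{M}_x(M)$, where $p\in[0,1]\setminus\{1/2\}$, such that for any finite sequence of distinct elements $a_1,\dots,a_n,b_1,\dots,b_m$ of $M$, $\nu_p\big(\bigwedge_{i=1}^n R(x,a_i)\wedge\bigwedge_{j=1}^m\neg R(x,b_j)\big)=p^n(1-p)^m$. By quantifier elimination $\nu_p$ is unique. *)

theory Defs
  imports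
    "HOL-Analysis.Analysis"
    "HOL-Number_Theory.Number_Theory"
    "HOL-Library.Infinite_Set"
begin

section \<open>First-order logic in the language with one binary relation symbol\<close>

record 'm relstruct =
  universe :: "'m set"
  edge :: "'m \<Rightarrow> 'm \<Rightarrow> bool"

datatype (params_tm: 'm) tm = Var nat | Par 'm
  for map: map_tm

text \<open>Formulas may contain elements of \<^typ>\<open>'m\<close> as parameters; formulas of the bare language
  are those with \<open>params \<phi> = {}\<close>.\<close>

datatype (params: 'm) fm =
    Verum
  | Equal "'m tm" "'m tm"
  | Rel "'m tm" "'m tm"
  | Neg "'m fm"
  | Conj "'m fm" "'m fm"
  | Ex nat "'m fm"
  for map: map_params

primrec fv_tm :: "'m tm \<Rightarrow> nat set" where
  "fv_tm (Var v) = {v}"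
| "fv_tm (Par b) = {}"

primrec fv :: "'m fm \<Rightarrow> nat set" where
  "fv Verum = {}"
| "fv (Equal s t) = fv_tm s \<union> fv_tm t"
| "fv (Rel s t) = fv_tm s \<union> fv_tm t"
| "fv (Neg \<phi>) = fv \<phi>"
| "fv (Conj \<phi> \<psi>) = fv \<phi> \<union> fv \<psi>"
| "fv (Ex v \<phi>) = fv \<phi> - {v}"

primrec val :: "(nat \<Rightarrow> 'm) \<Rightarrow> 'm tm \<Rightarrow> 'm" where
  "val e (Var v) = e v"
| "val e (Par b) = b"

primrec sat :: "'m relstruct \<Rightarrow> (nat \<Rightarrow> 'm) \<Rightarrow> 'm fm \<Rightarrow> bool" where
  "sat M e Verum \<longleftrightarrow> True"
| "sat M e (Equal s t) \<longleftrightarrow> val e s = val e t"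
| "sat M e (Rel s t) \<longleftrightarrow> edge M (val e s) (val e t)"
| "sat M e (Neg \<phi>) \<longleftrightarrow> \<not> sat M e \<phi>"
| "sat M e (Conj \<phi> \<psi>) \<longleftrightarrow> sat M e \<phi> \<and> sat M e \<psi>"
| "sat M e (Ex v \<phi>) \<longleftrightarrow> (\<exists>a\<in>universe M. sat M (e(v := a)) \<phi>)"

abbreviation Disj :: "'m fm \<Rightarrow> 'm fm \<Rightarrow> 'm fm" where
  "Disj \<phi> \<psi> \<equiv> Neg (Conj (Neg \<phi>) (Neg \<psi>))"

definition Conjs :: "'m fm list \<Rightarrow> 'm fm" where
  "Conjs \<phi>s = foldr Conj \<phi>s Verum"

primrec subst_tm :: "nat \<Rightarrow> 'm \<Rightarrow> 'm tm \<Rightarrow> 'm tm" where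
  "subst_tm y b (Var v) = (if v = y then Par b else Var v)"
| "subst_tm y b (Par c) = Par c"

text \<open>\<open>subst y b \<phi>\<close> is \<open>\<phi>(b/y)\<close>; a parameter is a closed term, so nothing can be captured.\<close>

primrec subst :: "nat \<Rightarrow> 'm \<Rightarrow> 'm fm \<Rightarrow> 'm fm" where
  "subst y b Verum = Verum"
| "subst y b (Equal s t) = Equal (subst_tm y b s) (subst_tm y b t)"
| "subst y b (Rel s t) = Rel (subst_tm y b s) (subst_tm y b t)"
| "subst y b (Neg \<phi>) = Neg (subst y b \<phi>)"
| "subst y b (Conj \<phi> \<psi>) = Conj (subst y b \<phi>) (subst y b \<psi>)"
| "subst y b (Ex v \<phi>) = Ex v (if v = y then \<phi> else subst y b \<phi>)"

definition formulas :: "nat \<Rightarrow> 'm relstruct \<Rightarrow> 'm fm set" where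
  "formulas x M = {\<phi>. fv \<phi> \<subseteq> {x} \<and> params \<phi> \<subseteq> universe M}"

text \<open>Truth of \<open>\<phi>(a)\<close> for \<open>\<phi>\<close> with at most one free variable: the assignment is constant, so there
  is no need to name that variable.\<close>

abbreviation holds_at :: "'m relstruct \<Rightarrow> 'm fm \<Rightarrow> 'm \<Rightarrow> bool" where
  "holds_at M \<phi> a \<equiv> sat M (\<lambda>_. a) \<phi>"


section \<open>Type spaces\<close>

text \<open>Consistency of a set of formulas over \<open>M\<close> with the elementary diagram of \<open>M\<close> amounts, by
  compactness, to finite satisfiability in \<open>M\<close>.\<close>

definition types :: "nat \<Rightarrow> 'm relstruct \<Rightarrow> 'm fm set set" where
  "types x M = {p. p \<subseteq> formulas x M
      \<and> (\<forall>\<phi>\<in>formulas x M. \<phi> \<in> p \<or> Neg \<phi> \<in> p)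
      \<and> (\<forall>\<Phi>. finite \<Phi> \<and> \<Phi> \<subseteq> p \<longrightarrow> (\<exists>a\<in>universe M. \<forall>\<phi>\<in>\<Phi>. holds_at M \<phi> a))}"

definition tp :: "nat \<Rightarrow> 'm relstruct \<Rightarrow> 'm \<Rightarrow> 'm fm set" where
  "tp x M a = {\<phi> \<in> formulas x M. holds_at M \<phi> a}"

definition type_space :: "nat \<Rightarrow> 'm relstruct \<Rightarrow> 'm fm set topology" where
  "type_space x M = topology_generated_by ((\<lambda>\<phi>. {p \<in> types x M. \<phi> \<in> p}) ` formulas x M)"


section \<open>Keisler measures\<close>

text \<open>A function on formulas modulo equivalence in \<open>M\<close> is encoded as an equivalence-invariant
  function on formulas.  Measures are \<^const>\<open>extensional\<close>, so that equality of measures means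
  equality of their values on the formulas over \<open>M\<close>.\<close>

definition keisler_measures :: "nat \<Rightarrow> 'm relstruct \<Rightarrow> ('m fm \<Rightarrow> real) set" where
  "keisler_measures x M = {\<nu> \<in> extensional (formulas x M).
      (\<forall>\<phi>\<in>formulas x M. \<forall>\<psi>\<in>formulas x M.
          (\<forall>a\<in>universe M. holds_at M \<phi> a \<longleftrightarrow> holds_at M \<psi> a) \<longrightarrow> \<nu> \<phi> = \<nu> \<psi>)
    \<and> (\<forall>\<phi>\<in>formulas x M. 0 \<le> \<nu> \<phi>)
    \<and> \<nu> Verum = 1
    \<and> (\<forall>\<phi>\<in>formulas x M. \<forall>\<psi>\<in>formulas x M.
          (\<forall>a\<in>universe M. \<not> (holds_at M \<phi> a \<and> holds_at M \<psi> a))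
            \<longrightarrow> \<nu> (Disj \<phi> \<psi>) = \<nu> \<phi> + \<nu> \<psi>)}"

definition dirac :: "nat \<Rightarrow> 'm relstruct \<Rightarrow> 'm fm set \<Rightarrow> 'm fm \<Rightarrow> real" where
  "dirac x M p = restrict (\<lambda>\<phi>. if \<phi> \<in> p then 1 else 0) (formulas x M)"

definition conv_measures :: "nat \<Rightarrow> 'm relstruct \<Rightarrow> ('m fm \<Rightarrow> real) set" where
  "conv_measures x M =
    {restrict (\<lambda>\<phi>. \<Sum>i<n. r i * dirac x M (tp x M (a i)) \<phi>) (formulas x M) | n a r.
       n \<ge> (1::nat) \<and> (\<forall>i<n. a i \<in> universe M) \<and> (\<forall>i<n. 0 < r i) \<and> (\<Sum>i<n. r i) = 1}"

definition counting_measure :: "nat \<Rightarrow> 'm relstruct \<Rightarrow> 'm fm \<Rightarrow> real" where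
  "counting_measure x M = restrict
     (\<lambda>\<phi>. real (card {a \<in> universe M. holds_at M \<phi> a}) / real (card (universe M))) (formulas x M)"

text \<open>\<open>defining_fun x y \<phi> M \<nu> F\<close>: the function \<open>F\<close> witnesses that \<open>\<nu>\<close> is \<open>\<phi>\<close>-definable, for
  \<open>\<phi> = \<phi>(x, y)\<close>.\<close>

definition defining_fun ::
    "nat \<Rightarrow> nat \<Rightarrow> 'm fm \<Rightarrow> 'm relstruct \<Rightarrow> ('m fm \<Rightarrow> real) \<Rightarrow> ('m fm set \<Rightarrow> real) \<Rightarrow> bool" where
  "defining_fun x y \<phi> M \<nu> F \<longleftrightarrow>
      F \<in> extensional (types y M)
    \<and> continuous_map (type_space y M) (top_of_set {0..1}) F
    \<and> (\<forall>b\<in>universe M. F (tp y M b) = \<nu> (subst y b \<phi>))"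

definition definable_for ::
    "nat \<Rightarrow> nat \<Rightarrow> 'm fm \<Rightarrow> 'm relstruct \<Rightarrow> ('m fm \<Rightarrow> real) \<Rightarrow> bool" where
  "definable_for x y \<phi> M \<nu> \<longleftrightarrow> (\<exists>F. defining_fun x y \<phi> M \<nu> F)"

definition the_defining_fun ::
    "nat \<Rightarrow> nat \<Rightarrow> 'm fm \<Rightarrow> 'm relstruct \<Rightarrow> ('m fm \<Rightarrow> real) \<Rightarrow> 'm fm set \<Rightarrow> real" where
  "the_defining_fun x y \<phi> M \<nu> = (THE F. defining_fun x y \<phi> M \<nu> F)"

text \<open>No theory is imposed on \<open>M\<close> here; the notion is only of interest when \<open>M\<close> is a model of the
  theory of the random graph.\<close>

definition unfair_coin_flipping_measure ::
    "nat \<Rightarrow> 'm relstruct \<Rightarrow> real \<Rightarrow> ('m fm \<Rightarrow> real) \<Rightarrow> bool" where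
  "unfair_coin_flipping_measure x M p \<nu> \<longleftrightarrow>
      p \<in> {0..1} - {1/2} \<and> \<nu> \<in> keisler_measures x M
    \<and> (\<forall>as bs. distinct (as @ bs) \<and> set (as @ bs) \<subseteq> universe M \<longrightarrow>
         \<nu> (Conj (Conjs (map (\<lambda>a. Rel (Var x) (Par a)) as))
                 (Conjs (map (\<lambda>b. Neg (Rel (Var x) (Par b))) bs)))
           = p ^ length as * (1 - p) ^ length bs)"


section \<open>Ultraproducts and ultralimits of measures\<close>

definition ultrafilter :: "'i filter \<Rightarrow> bool" where
  "ultrafilter D \<longleftrightarrow> D \<noteq> bot \<and> (\<forall>P. eventually P D \<or> eventually (\<lambda>i. \<not> P i) D)"

definition nonprincipal_ultrafilter :: "'i filter \<Rightarrow> bool" where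
  "nonprincipal_ultrafilter D \<longleftrightarrow> ultrafilter D \<and> (\<nexists>i. D = principal {i})"

definition eq_mod :: "'i filter \<Rightarrow> ('i \<Rightarrow> 'm relstruct) \<Rightarrow> (('i \<Rightarrow> 'm) \<times> ('i \<Rightarrow> 'm)) set" where
  "eq_mod D M = {(f, g). (\<forall>i. f i \<in> universe (M i)) \<and> (\<forall>i. g i \<in> universe (M i))
                   \<and> eventually (\<lambda>i. f i = g i) D}"

definition ultraproduct ::
    "'i filter \<Rightarrow> ('i \<Rightarrow> 'm relstruct) \<Rightarrow> ('i \<Rightarrow> 'm) set relstruct" where
  "ultraproduct D M =
    \<lparr> universe = {f. \<forall>i. f i \<in> universe (M i)} // eq_mod D M,
      edge = (\<lambda>A B. \<exists>f\<in>A. \<exists>g\<in>B. eventually (\<lambda>i. edge (M i) (f i) (g i)) D) \<rparr>"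

definition repr :: "('i \<Rightarrow> 'm) set \<Rightarrow> 'i \<Rightarrow> 'm" where
  "repr A = (SOME f. f \<in> A)"

text \<open>The choice of representatives of the parameters is immaterial, and the limit exists; see
  \<open>tendsto_ultralimit\<close> below.\<close>

definition ultralimit ::
    "nat \<Rightarrow> 'i filter \<Rightarrow> ('i \<Rightarrow> 'm relstruct) \<Rightarrow> ('i \<Rightarrow> 'm fm \<Rightarrow> real)
      \<Rightarrow> ('i \<Rightarrow> 'm) set fm \<Rightarrow> real" where
  "ultralimit x D M \<mu> = restrict
     (\<lambda>\<phi>. Lim D (\<lambda>i. \<mu> i (map_params (\<lambda>b. repr b i) \<phi>))) (formulas x (ultraproduct D M))"

definition pseudofinite ::
    "nat \<Rightarrow> 'i filter \<Rightarrow> ('i \<Rightarrow> 'm relstruct) \<Rightarrow> (('i \<Rightarrow> 'm) set fm \<Rightarrow> real) \<Rightarrow> bool" where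
  "pseudofinite x D M \<nu> \<longleftrightarrow>
     (\<exists>\<nu>'. (\<forall>i. \<nu>' i \<in> conv_measures x (M i)) \<and> \<nu> = ultralimit x D M \<nu>')"


section \<open>Paley graphs\<close>

text \<open>For prime \<open>q\<close>, the field with \<open>q\<close> elements is the residue ring modulo \<open>q\<close>.\<close>

definition paley :: "nat \<Rightarrow> int relstruct" where
  "paley q = (let F = residue_ring (int q) in
    \<lparr> universe = carrier F,
      edge = (\<lambda>a b. a \<noteq> b \<and> (\<exists>z\<in>carrier F. z [^]\<^bsub>F\<^esub> (2::nat) = a \<ominus>\<^bsub>F\<^esub> b)) \<rparr>)"

definition paley_prime :: "nat \<Rightarrow> nat" where
  "paley_prime = enumerate {q. prime q \<and> [q = 1] (mod 4)}"


section \<open>Well-definedness\<close>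

lemma ultrafilter_not_iff:
  assumes "ultrafilter D"
  shows "eventually (\<lambda>i. \<not> P i) D \<longleftrightarrow> \<not> eventually P D"
proof
  assume a: "eventually (\<lambda>i. \<not> P i) D"
  show "\<not> eventually P D"
  proof
    assume "eventually P D"
    with a have "eventually (\<lambda>i. False) D" by eventually_elim auto
    with assms show False by (simp add: ultrafilter_def eventually_False)
  qed
qed (use assms in \<open>auto simp: ultrafilter_def\<close>)

lemma ultrafilter_tendsto_Lim:
  fixes f :: "'i \<Rightarrow> real"
  assumes D: "ultrafilter D" and bd: "\<And>i. f i \<in> {a..b}"
  shows "(f \<longlongrightarrow> Lim D f) D" "Lim D f \<in> {a..b}"
proof -
  have nb: "D \<noteq> bot" using D by (simp add: ultrafilter_def)
  then have fb: "filtermap f D \<noteq> bot" by (simp add: filtermap_bot_iff)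
  have ev: "eventually (\<lambda>z. z \<in> {a..b}) (filtermap f D)"
    using bd by (simp add: eventually_filtermap)
  obtain l where l: "l \<in> {a..b}" "inf (nhds l) (filtermap f D) \<noteq> bot"
    using compact_Icc[of a b] fb ev unfolding compact_filter by blast
  have lim: "(f \<longlongrightarrow> l) D"
  proof (rule topological_tendstoI)
    fix S :: "real set" assume S: "open S" "l \<in> S"
    show "eventually (\<lambda>i. f i \<in> S) D"
    proof (rule ccontr)
      assume "\<not> eventually (\<lambda>i. f i \<in> S) D"
      then have "eventually (\<lambda>z. z \<notin> S) (filtermap f D)"
        using ultrafilter_not_iff[OF D] by (simp add: eventually_filtermap)
      moreover have "eventually (\<lambda>z. z \<in> S) (nhds l)"
        using S by (rule eventually_nhds_in_open)
      ultimately have "eventually (\<lambda>z. False) (inf (nhds l) (filtermap f D))"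
        unfolding eventually_inf by (intro exI[of _ "\<lambda>z. z \<in> S"] exI[of _ "\<lambda>z. z \<notin> S"]) auto
      with l show False by (simp add: eventually_False)
    qed
  qed
  have eq: "Lim D f = l" using tendsto_Lim[OF nb lim] .
  show "(f \<longlongrightarrow> Lim D f) D" "Lim D f \<in> {a..b}" using lim l eq by auto
qed

lemma finite_params: "finite (params \<phi>)"
proof -
  have "finite (params_tm t)" for t :: "'a tm" by (cases t) auto
  then show ?thesis by (induction \<phi>) auto
qed

lemma fv_tm_map_tm [simp]: "fv_tm (map_tm f t) = fv_tm t"
  by (cases t) auto

lemma fv_map_params [simp]: "fv (map_params f \<phi>) = fv \<phi>"
  by (induction \<phi>) auto

lemma equiv_eq_mod: "equiv {f. \<forall>i. f i \<in> universe (M i)} (eq_mod D M)"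
proof (rule equivI)
  show "eq_mod D M \<subseteq> {f. \<forall>i. f i \<in> universe (M i)} \<times> {f. \<forall>i. f i \<in> universe (M i)}"
    by (auto simp: eq_mod_def)
  show "refl_on {f. \<forall>i. f i \<in> universe (M i)} (eq_mod D M)"
    by (auto simp: refl_on_def eq_mod_def)
  show "sym (eq_mod D M)"
    by (auto simp: sym_def eq_mod_def eq_commute)
  show "trans (eq_mod D M)"
    by (auto simp: trans_def eq_mod_def elim: eventually_elim2)
qed

lemma universe_ultraproduct:
  "universe (ultraproduct D M) = {f. \<forall>i. f i \<in> universe (M i)} // eq_mod D M"
  by (simp add: ultraproduct_def)

lemma ultraproduct_memD:
  assumes "A \<in> universe (ultraproduct D M)" "f \<in> A"
  shows "f i \<in> universe (M i)"
  using assms equiv_eq_mod[of M D] unfolding universe_ultraproduct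
  by (auto simp: quotient_def eq_mod_def)

lemma ultraproduct_eventually_eq:
  assumes "A \<in> universe (ultraproduct D M)" "f \<in> A" "g \<in> A"
  shows "eventually (\<lambda>i. f i = g i) D"
  using quotient_eq_iff[OF equiv_eq_mod assms(1)[unfolded universe_ultraproduct]
      assms(1)[unfolded universe_ultraproduct] assms(2,3)]
  by (simp add: eq_mod_def)

lemma repr_mem:
  assumes "A \<in> universe (ultraproduct D M)"
  shows "repr A \<in> A"
proof -
  have "A \<noteq> {}"
    using assms in_quotient_imp_non_empty[OF equiv_eq_mod] unfolding universe_ultraproduct by blast
  then show ?thesis unfolding repr_def by (simp add: some_in_eq)
qed

lemma repr_eq_iff:
  assumes "A \<in> universe (ultraproduct D M)" "B \<in> universe (ultraproduct D M)"
  shows "A = B \<longleftrightarrow> eventually (\<lambda>i. repr A i = repr B i) D"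
proof -
  have "(repr A, repr B) \<in> eq_mod D M \<longleftrightarrow> eventually (\<lambda>i. repr A i = repr B i) D"
    using ultraproduct_memD[OF assms(1) repr_mem[OF assms(1)]]
      ultraproduct_memD[OF assms(2) repr_mem[OF assms(2)]]
    by (simp add: eq_mod_def)
  then show ?thesis
    using quotient_eq_iff[OF equiv_eq_mod assms[unfolded universe_ultraproduct]
        repr_mem[OF assms(1)] repr_mem[OF assms(2)]] by simp
qed

lemma repr_edge_iff:
  assumes "A \<in> universe (ultraproduct D M)" "B \<in> universe (ultraproduct D M)"
  shows "edge (ultraproduct D M) A B \<longleftrightarrow> eventually (\<lambda>i. edge (M i) (repr A i) (repr B i)) D"
proof
  assume "edge (ultraproduct D M) A B"
  then obtain f g where fg: "f \<in> A" "g \<in> B" "eventually (\<lambda>i. edge (M i) (f i) (g i)) D"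
    by (auto simp: ultraproduct_def)
  from fg(3) ultraproduct_eventually_eq[OF assms(1) fg(1) repr_mem[OF assms(1)]]
    ultraproduct_eventually_eq[OF assms(2) fg(2) repr_mem[OF assms(2)]]
  show "eventually (\<lambda>i. edge (M i) (repr A i) (repr B i)) D"
    by eventually_elim simp
qed (use assms repr_mem in \<open>force simp: ultraproduct_def\<close>)

theorem los:
  assumes D: "ultrafilter D"
  assumes "\<And>v. e v \<in> universe (ultraproduct D M)" "params \<phi> \<subseteq> universe (ultraproduct D M)"
  shows "sat (ultraproduct D M) e \<phi> \<longleftrightarrow>
    eventually (\<lambda>i. sat (M i) (\<lambda>v. repr (e v) i) (map_params (\<lambda>b. repr b i) \<phi>)) D"
  using assms(2,3)
proof (induction \<phi> arbitrary: e)
  case Verum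
  then show ?case by simp
next
  case (Equal s t)
  have v: "val (\<lambda>v. repr (e v) i) (map_tm (\<lambda>b. repr b i) t) = repr (val e t) i" for i t
    by (cases t) auto
  have "val e u \<in> universe (ultraproduct D M)" if "params_tm u \<subseteq> universe (ultraproduct D M)" for u
    using Equal that by (cases u) auto
  with Equal show ?case by (simp add: v repr_eq_iff[of _ D M])
next
  case (Rel s t)
  have v: "val (\<lambda>v. repr (e v) i) (map_tm (\<lambda>b. repr b i) t) = repr (val e t) i" for i t
    by (cases t) auto
  have "val e u \<in> universe (ultraproduct D M)" if "params_tm u \<subseteq> universe (ultraproduct D M)" for u
    using Rel that by (cases u) auto
  with Rel show ?case by (simp add: v repr_edge_iff[of _ D M])
next
  case (Neg \<phi>)
  then show ?case by (simp add: ultrafilter_not_iff[OF D])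
next
  case (Conj \<phi> \<psi>)
  then show ?case by (simp add: eventually_conj_iff)
next
  case (Ex x \<phi>)
  let ?N = "ultraproduct D M"
  let ?Q = "\<lambda>i a. sat (M i) ((\<lambda>v. repr (e v) i)(x := a)) (map_params (\<lambda>b. repr b i) \<phi>)"
  have IH: "sat ?N (e(x := A)) \<phi> \<longleftrightarrow> eventually (\<lambda>i. ?Q i (repr A i)) D" if A: "A \<in> universe ?N" for A
  proof -
    have upd: "(\<lambda>v. repr ((e(x := A)) v) i) = (\<lambda>v. repr (e v) i)(x := repr A i)" for i
      by auto
    have "(e(x := A)) v \<in> universe ?N" for v using Ex.prems(1) A by simp
    moreover have "params \<phi> \<subseteq> universe ?N" using Ex.prems(2) by simp
    ultimately show ?thesis by (subst Ex.IH) (simp_all only: upd)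
  qed
  show ?case
  proof
    assume "sat ?N e (Ex x \<phi>)"
    then obtain A where A: "A \<in> universe ?N" "sat ?N (e(x := A)) \<phi>" by auto
    then have "eventually (\<lambda>i. ?Q i (repr A i)) D" using IH by blast
    then show "eventually (\<lambda>i. sat (M i) (\<lambda>v. repr (e v) i) (map_params (\<lambda>b. repr b i) (Ex x \<phi>))) D"
      using ultraproduct_memD[OF A(1) repr_mem[OF A(1)]] by (auto elim!: eventually_mono)
  next
    assume ev: "eventually (\<lambda>i. sat (M i) (\<lambda>v. repr (e v) i) (map_params (\<lambda>b. repr b i) (Ex x \<phi>))) D"
    define f where "f i = (if \<exists>a\<in>universe (M i). ?Q i a then SOME a. a \<in> universe (M i) \<and> ?Q i a
                           else repr (e 0) i)" for i
    have f: "f i \<in> universe (M i) \<and> ((\<exists>a\<in>universe (M i). ?Q i a) \<longrightarrow> ?Q i (f i))" for i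
    proof (cases "\<exists>a\<in>universe (M i). ?Q i a")
      case True
      then show ?thesis
        unfolding f_def using someI_ex[of "\<lambda>a. a \<in> universe (M i) \<and> ?Q i a"] by auto
    next
      case False
      then show ?thesis
        unfolding f_def using ultraproduct_memD[OF Ex.prems(1) repr_mem[OF Ex.prems(1)]] by auto
    qed
    define A where "A = eq_mod D M `` {f}"
    have A: "A \<in> universe ?N"
      unfolding A_def universe_ultraproduct using f by (intro quotientI) auto
    have "f \<in> A"
      unfolding A_def using f by (auto simp: eq_mod_def)
    from ultraproduct_eventually_eq[OF A repr_mem[OF A] this] ev
    have "eventually (\<lambda>i. ?Q i (repr A i)) D"
      by eventually_elim (use f in auto)
    then show "sat ?N e (Ex x \<phi>)" using IH[OF A] A by auto
  qed
qed

lemma map_params_in_formulas: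
  assumes "\<phi> \<in> formulas x (ultraproduct D M)"
      and "\<And>b. b \<in> params \<phi> \<Longrightarrow> \<rho> b \<in> b"
  shows "map_params (\<lambda>b. \<rho> b i) \<phi> \<in> formulas x (M i)"
proof -
  have "params (map_params (\<lambda>b. \<rho> b i) \<phi>) = (\<lambda>b. \<rho> b i) ` params \<phi>"
    by (simp add: fm.set_map)
  then show ?thesis
    using assms ultraproduct_memD unfolding formulas_def by (fastforce simp: subset_iff)
qed

lemma keisler_measures_cong:
  assumes "\<nu> \<in> keisler_measures x M" "\<phi> \<in> formulas x M" "\<psi> \<in> formulas x M"
      and "\<And>a. a \<in> universe M \<Longrightarrow> holds_at M \<phi> a \<longleftrightarrow> holds_at M \<psi> a"
  shows "\<nu> \<phi> = \<nu> \<psi>"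
  using assms unfolding keisler_measures_def by blast

lemma keisler_measures_Disj:
  assumes "\<nu> \<in> keisler_measures x M" "\<phi> \<in> formulas x M" "\<psi> \<in> formulas x M"
      and "\<And>a. a \<in> universe M \<Longrightarrow> \<not> (holds_at M \<phi> a \<and> holds_at M \<psi> a)"
  shows "\<nu> (Disj \<phi> \<psi>) = \<nu> \<phi> + \<nu> \<psi>"
  using assms unfolding keisler_measures_def by blast

lemma keisler_measures_Neg:
  assumes "\<nu> \<in> keisler_measures x M" "\<phi> \<in> formulas x M"
  shows "\<nu> (Neg \<phi>) = 1 - \<nu> \<phi>"
proof -
  have F: "Neg \<phi> \<in> formulas x M" "Disj \<phi> (Neg \<phi>) \<in> formulas x M" "Verum \<in> formulas x M"
    using assms(2) by (auto simp: formulas_def)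
  have "\<nu> (Disj \<phi> (Neg \<phi>)) = \<nu> \<phi> + \<nu> (Neg \<phi>)"
    by (rule keisler_measures_Disj[OF assms F(1)]) simp
  moreover have "\<nu> (Disj \<phi> (Neg \<phi>)) = \<nu> Verum"
    by (rule keisler_measures_cong[OF assms(1) F(2,3)]) simp
  moreover have "\<nu> Verum = 1" using assms(1) by (simp add: keisler_measures_def)
  ultimately show ?thesis by simp
qed

lemma keisler_measures_range:
  assumes "\<nu> \<in> keisler_measures x M" "\<phi> \<in> formulas x M"
  shows "\<nu> \<phi> \<in> {0..1}"
proof -
  have "Neg \<phi> \<in> formulas x M" using assms(2) by (simp add: formulas_def)
  then have "0 \<le> \<nu> \<phi>" "0 \<le> \<nu> (Neg \<phi>)"
    using assms unfolding keisler_measures_def by blast+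
  then show ?thesis using keisler_measures_Neg[OF assms] by simp
qed

lemma counting_measure_keisler:
  assumes fin: "finite (universe M)" and ne: "universe M \<noteq> {}"
  shows "counting_measure x M \<in> keisler_measures x M"
proof -
  let ?c = "counting_measure x M" and ?S = "\<lambda>\<phi>. {a \<in> universe M. holds_at M \<phi> a}"
  have val: "?c \<phi> = real (card (?S \<phi>)) / real (card (universe M))" if "\<phi> \<in> formulas x M" for \<phi>
    using that by (simp add: counting_measure_def)
  have card: "card (universe M) > 0" using fin ne by (simp add: card_gt_0_iff)
  have V: "Verum \<in> formulas x M" by (simp add: formulas_def)
  have one: "?c Verum = 1" using card val[OF V] by simp
  have inv: "?c \<phi> = ?c \<psi>" if "\<phi> \<in> formulas x M" "\<psi> \<in> formulas x M"
    "\<forall>a\<in>universe M. holds_at M \<phi> a \<longleftrightarrow> holds_at M \<psi> a" for \<phi> \<psi>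
  proof -
    have "?S \<phi> = ?S \<psi>" using that(3) by blast
    then show ?thesis using val[OF that(1)] val[OF that(2)] by simp
  qed
  have add: "?c (Disj \<phi> \<psi>) = ?c \<phi> + ?c \<psi>" if F: "\<phi> \<in> formulas x M" "\<psi> \<in> formulas x M"
    and dis: "\<forall>a\<in>universe M. \<not> (holds_at M \<phi> a \<and> holds_at M \<psi> a)" for \<phi> \<psi>
  proof -
    have "Disj \<phi> \<psi> \<in> formulas x M" using F by (simp add: formulas_def)
    moreover have "?S (Disj \<phi> \<psi>) = ?S \<phi> \<union> ?S \<psi>" by auto
    moreover have "card (?S \<phi> \<union> ?S \<psi>) = card (?S \<phi>) + card (?S \<psi>)"
      using fin dis by (intro card_Un_disjoint) auto
    ultimately show ?thesis using val F by (simp only: of_nat_add add_divide_distrib)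
  qed
  have ext: "?c \<in> extensional (formulas x M)" by (simp add: counting_measure_def)
  have "0 \<le> ?c \<phi>" if "\<phi> \<in> formulas x M" for \<phi> using val[OF that] by simp
  then show ?thesis
    unfolding keisler_measures_def by (intro CollectI conjI ballI impI ext inv one add) simp_all
qed

lemma conv_measures_keisler: "conv_measures x M \<subseteq> keisler_measures x M"
proof
  fix \<nu> assume "\<nu> \<in> conv_measures x M"
  then obtain n :: nat and a r where \<nu>:
    "\<nu> = restrict (\<lambda>\<phi>. \<Sum>i<n. r i * dirac x M (tp x M (a i)) \<phi>) (formulas x M)"
    "\<forall>i<n. a i \<in> universe M" "\<forall>i<n. 0 < r i" "(\<Sum>i<n. r i) = 1"
    unfolding conv_measures_def by blast
  have val: "\<nu> \<phi> = (\<Sum>i<n. r i * of_bool (holds_at M \<phi> (a i)))" if "\<phi> \<in> formulas x M" for \<phi>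
    using that by (simp add: \<nu>(1) dirac_def tp_def of_bool_def)
  have V: "Verum \<in> formulas x M" by (simp add: formulas_def)
  have one: "\<nu> Verum = 1" using val[OF V] \<nu>(4) by simp
  have inv: "\<nu> \<phi> = \<nu> \<psi>" if "\<phi> \<in> formulas x M" "\<psi> \<in> formulas x M"
    "\<forall>a\<in>universe M. holds_at M \<phi> a \<longleftrightarrow> holds_at M \<psi> a" for \<phi> \<psi>
    unfolding val[OF that(1)] val[OF that(2)] using that(3) \<nu>(2) by (intro sum.cong) auto
  have add: "\<nu> (Disj \<phi> \<psi>) = \<nu> \<phi> + \<nu> \<psi>" if F: "\<phi> \<in> formulas x M" "\<psi> \<in> formulas x M"
    and dis: "\<forall>a\<in>universe M. \<not> (holds_at M \<phi> a \<and> holds_at M \<psi> a)" for \<phi> \<psi>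
  proof -
    have D: "Disj \<phi> \<psi> \<in> formulas x M" using F by (simp add: formulas_def)
    show ?thesis
      unfolding val[OF F(1)] val[OF F(2)] val[OF D] sum.distrib[symmetric]
      using dis \<nu>(2) by (intro sum.cong) auto
  qed
  have ext: "\<nu> \<in> extensional (formulas x M)" by (simp add: \<nu>(1))
  have nonneg: "0 \<le> \<nu> \<phi>" if "\<phi> \<in> formulas x M" for \<phi>
    unfolding val[OF that] using \<nu>(3) by (intro sum_nonneg) (simp add: less_imp_le)
  show "\<nu> \<in> keisler_measures x M"
    unfolding keisler_measures_def by (intro CollectI conjI ballI impI ext inv one add nonneg) simp_all
qed

lemma tendsto_ultralimit:
  assumes D: "ultrafilter D" and \<mu>: "\<And>i. \<mu> i \<in> keisler_measures x (M i)"
      and \<phi>: "\<phi> \<in> formulas x (ultraproduct D M)"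
      and \<rho>: "\<And>b. b \<in> params \<phi> \<Longrightarrow> \<rho> b \<in> b"
  shows "((\<lambda>i. \<mu> i (map_params (\<lambda>b. \<rho> b i) \<phi>)) \<longlongrightarrow> ultralimit x D M \<mu> \<phi>) D"
proof -
  let ?g = "\<lambda>i. \<mu> i (map_params (\<lambda>b. repr b i) \<phi>)"
  have par: "params \<phi> \<subseteq> universe (ultraproduct D M)" using \<phi> by (simp add: formulas_def)
  have "?g i \<in> {0..1}" for i
    by (rule keisler_measures_range[OF \<mu> map_params_in_formulas[OF \<phi>]])
       (use par repr_mem[of _ D M] in blast)
  from ultrafilter_tendsto_Lim(1)[OF D this]
  have "(?g \<longlongrightarrow> ultralimit x D M \<mu> \<phi>) D"
    using \<phi> by (simp add: ultralimit_def)
  moreover have "eventually (\<lambda>i. \<forall>b\<in>params \<phi>. repr b i = \<rho> b i) D"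
  proof (intro eventually_ball_finite finite_params ballI)
    fix b assume b: "b \<in> params \<phi>"
    with par have "b \<in> universe (ultraproduct D M)" by blast
    from ultraproduct_eventually_eq[OF this repr_mem[OF this] \<rho>[OF b]]
    show "eventually (\<lambda>i. repr b i = \<rho> b i) D" .
  qed
  then have "eventually (\<lambda>i. ?g i = \<mu> i (map_params (\<lambda>b. \<rho> b i) \<phi>)) D"
  proof eventually_elim
    case (elim i)
    then have "map_params (\<lambda>b. repr b i) \<phi> = map_params (\<lambda>b. \<rho> b i) \<phi>"
      by (intro fm.map_cong0) blast
    then show ?case by simp
  qed
  ultimately show ?thesis by (rule Lim_transform_eventually)
qed

lemma tendsto_ultralimit_repr:
  assumes D: "ultrafilter D" and \<mu>: "\<And>i. \<mu> i \<in> keisler_measures x (M i)"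
      and \<phi>: "\<phi> \<in> formulas x (ultraproduct D M)"
  shows "((\<lambda>i. \<mu> i (map_params (\<lambda>b. repr b i) \<phi>)) \<longlongrightarrow> ultralimit x D M \<mu> \<phi>) D"
  by (rule tendsto_ultralimit[OF D \<mu> \<phi>]) (use \<phi> repr_mem[of _ D M] in \<open>auto simp: formulas_def\<close>)

lemma valid_ultraproduct:
  assumes D: "ultrafilter D" and \<phi>: "\<phi> \<in> formulas x (ultraproduct D M)"
      and ne: "\<And>i. universe (M i) \<noteq> {}"
      and val: "\<And>a. a \<in> universe (ultraproduct D M) \<Longrightarrow> holds_at (ultraproduct D M) \<phi> a"
  shows "eventually (\<lambda>i. \<forall>a\<in>universe (M i). holds_at (M i) (map_params (\<lambda>b. repr b i) \<phi>) a) D"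
proof (rule ccontr)
  let ?N = "ultraproduct D M"
  let ?Q = "\<lambda>i a. holds_at (M i) (map_params (\<lambda>b. repr b i) \<phi>) a"
  assume "\<not> ?thesis"
  then have ev: "eventually (\<lambda>i. \<exists>a\<in>universe (M i). \<not> ?Q i a) D"
    by (subst (asm) ultrafilter_not_iff[OF D, symmetric]) simp
  have "\<forall>i. \<exists>a. a \<in> universe (M i) \<and> ((\<exists>a\<in>universe (M i). \<not> ?Q i a) \<longrightarrow> \<not> ?Q i a)"
    using ne by blast
  then obtain f where f: "\<And>i. f i \<in> universe (M i)"
      "\<And>i. (\<exists>a\<in>universe (M i). \<not> ?Q i a) \<Longrightarrow> \<not> ?Q i (f i)" by metis
  define A where "A = eq_mod D M `` {f}"
  have A: "A \<in> universe ?N"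
    unfolding A_def universe_ultraproduct using f(1) by (intro quotientI) auto
  have fA: "f \<in> A" unfolding A_def using f(1) by (auto simp: eq_mod_def)
  have par: "params \<phi> \<subseteq> universe ?N" using \<phi> by (simp add: formulas_def)
  have "eventually (\<lambda>i. ?Q i (repr A i)) D"
    using los[of D "\<lambda>_. A", OF D A par] val[OF A] by simp
  with ev ultraproduct_eventually_eq[OF A fA repr_mem[OF A]]
  have "eventually (\<lambda>i. False) D"
  proof eventually_elim
    case (elim i)
    with f(2)[of i] show ?case by simp
  qed
  with D show False by (simp add: ultrafilter_def eventually_False)
qed

theorem ultralimit_keisler:
  assumes D: "ultrafilter D" and \<mu>: "\<And>i. \<mu> i \<in> keisler_measures x (M i)"
      and ne: "\<And>i. universe (M i) \<noteq> {}"
  shows "ultralimit x D M \<mu> \<in> keisler_measures x (ultraproduct D M)"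
proof -
  let ?N = "ultraproduct D M" and ?\<nu> = "ultralimit x D M \<mu>"
  let ?m = "\<lambda>i \<phi>. map_params (\<lambda>b. repr b i) \<phi>"
  note lim = tendsto_ultralimit_repr[where \<mu> = \<mu>, OF D \<mu>]
  have nb: "D \<noteq> bot" using D by (simp add: ultrafilter_def)
  have m: "?m i \<phi> \<in> formulas x (M i)" if "\<phi> \<in> formulas x ?N" for i \<phi>
    by (rule map_params_in_formulas[OF that]) (use that repr_mem[of _ D M] in \<open>auto simp: formulas_def\<close>)
  have inv: "?\<nu> \<phi> = ?\<nu> \<psi>" if F: "\<phi> \<in> formulas x ?N" "\<psi> \<in> formulas x ?N"
    and eq: "\<forall>a\<in>universe ?N. holds_at ?N \<phi> a \<longleftrightarrow> holds_at ?N \<psi> a" for \<phi> \<psi>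
  proof -
    let ?c = "Conj (Neg (Conj \<phi> (Neg \<psi>))) (Neg (Conj \<psi> (Neg \<phi>)))"
    have "?c \<in> formulas x ?N" using F by (auto simp: formulas_def)
    from valid_ultraproduct[OF D this ne] eq
    have "eventually (\<lambda>i. \<forall>a\<in>universe (M i). holds_at (M i) (?m i ?c) a) D" by simp
    then have "eventually (\<lambda>i. \<mu> i (?m i \<phi>) = \<mu> i (?m i \<psi>)) D"
    proof eventually_elim
      case (elim i)
      then show ?case
        by (intro keisler_measures_cong[OF \<mu> m[OF F(1)] m[OF F(2)]]) auto
    qed
    with lim[OF F(1)] have "((\<lambda>i. \<mu> i (?m i \<psi>)) \<longlongrightarrow> ?\<nu> \<phi>) D"
      by (rule Lim_transform_eventually)
    from tendsto_unique[OF nb this lim[OF F(2)]] show ?thesis .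
  qed
  have nonneg: "0 \<le> ?\<nu> \<phi>" if F: "\<phi> \<in> formulas x ?N" for \<phi>
    by (rule tendsto_lowerbound[OF lim[OF F] _ nb])
       (use keisler_measures_range[OF \<mu> m[OF F]] in auto)
  have V: "Verum \<in> formulas x ?N" by (simp add: formulas_def)
  have "\<mu> i Verum = 1" for i using \<mu>[of i] by (simp add: keisler_measures_def)
  then have "((\<lambda>_. 1) \<longlongrightarrow> ?\<nu> Verum) D" using lim[OF V] by simp
  then have one: "?\<nu> Verum = 1" using nb by (simp add: tendsto_const_iff)
  have add: "?\<nu> (Disj \<phi> \<psi>) = ?\<nu> \<phi> + ?\<nu> \<psi>" if F: "\<phi> \<in> formulas x ?N" "\<psi> \<in> formulas x ?N"
    and dis: "\<forall>a\<in>universe ?N. \<not> (holds_at ?N \<phi> a \<and> holds_at ?N \<psi> a)" for \<phi> \<psi>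
  proof -
    have F': "Neg (Conj \<phi> \<psi>) \<in> formulas x ?N" "Disj \<phi> \<psi> \<in> formulas x ?N"
      using F by (auto simp: formulas_def)
    from valid_ultraproduct[OF D F'(1) ne] dis
    have "eventually (\<lambda>i. \<forall>a\<in>universe (M i). holds_at (M i) (?m i (Neg (Conj \<phi> \<psi>))) a) D" by simp
    then have "eventually (\<lambda>i. \<mu> i (?m i (Disj \<phi> \<psi>)) = \<mu> i (?m i \<phi>) + \<mu> i (?m i \<psi>)) D"
    proof eventually_elim
      case (elim i)
      then show ?case
        using keisler_measures_Disj[OF \<mu> m[OF F(1)] m[OF F(2)]] by simp
    qed
    with lim[OF F'(2)]
    have "((\<lambda>i. \<mu> i (?m i \<phi>) + \<mu> i (?m i \<psi>)) \<longlongrightarrow> ?\<nu> (Disj \<phi> \<psi>)) D"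
      by (rule Lim_transform_eventually)
    from tendsto_unique[OF nb this tendsto_add[OF lim[OF F(1)] lim[OF F(2)]]] show ?thesis .
  qed
  have "?\<nu> \<in> extensional (formulas x ?N)" by (simp add: ultralimit_def)
  then show ?thesis
    unfolding keisler_measures_def by (intro CollectI conjI ballI impI inv nonneg one add) simp_all
qed

lemma tp_in_types: "a \<in> universe M \<Longrightarrow> tp x M a \<in> types x M"
  unfolding types_def by (auto simp: tp_def formulas_def subset_iff)

lemma topspace_type_space: "topspace (type_space x M) = types x M"
proof -
  have "Verum \<in> formulas x M" "\<And>p. p \<in> types x M \<Longrightarrow> Verum \<in> p"
  proof -
    show V: "Verum \<in> formulas x M" by (simp add: formulas_def)
    fix p assume p: "p \<in> types x M"
    show "Verum \<in> p"
    proof (rule ccontr)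
      assume "Verum \<notin> p"
      with p V have "{Neg Verum} \<subseteq> p" unfolding types_def by blast
      with p have "\<exists>a\<in>universe M. \<forall>\<phi>\<in>{Neg Verum}. holds_at M \<phi> a"
        unfolding types_def by blast
      then show False by simp
    qed
  qed
  then show ?thesis unfolding type_space_def topology_generated_by_topspace by blast
qed

lemma types_inter_tp:
  assumes "p \<in> types x M" "finite \<Phi>" "\<Phi> \<subseteq> p"
  obtains a where "a \<in> universe M" "\<Phi> \<subseteq> tp x M a"
proof -
  have "\<exists>a\<in>universe M. \<forall>\<phi>\<in>\<Phi>. holds_at M \<phi> a" "\<Phi> \<subseteq> formulas x M"
    using assms unfolding types_def by simp_all blast
  then show thesis using that unfolding tp_def by blast
qed

lemma closure_of_realised_types:
  "(type_space x M) closure_of (tp x M ` universe M) = types x M"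
proof
  show "(type_space x M) closure_of (tp x M ` universe M) \<subseteq> types x M"
    using closure_of_subset_topspace[of "type_space x M"] by (simp add: topspace_type_space)
  show "types x M \<subseteq> (type_space x M) closure_of (tp x M ` universe M)"
  proof
    fix p assume p: "p \<in> types x M"
    have key: "\<exists>\<Phi>. finite \<Phi> \<and> \<Phi> \<subseteq> p \<and> (\<forall>q\<in>types x M. \<Phi> \<subseteq> q \<longrightarrow> q \<in> U)"
      if "generate_topology_on ((\<lambda>\<phi>. {p \<in> types x M. \<phi> \<in> p}) ` formulas x M) U" "p \<in> U" for U
      using that
    proof (induction rule: generate_topology_on.induct)
      case Empty
      then show ?case by simp
    next
      case (Int A B)
      then obtain \<Phi> \<Psi> where "finite \<Phi> \<and> \<Phi> \<subseteq> p \<and> (\<forall>q\<in>types x M. \<Phi> \<subseteq> q \<longrightarrow> q \<in> A)"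
        "finite \<Psi> \<and> \<Psi> \<subseteq> p \<and> (\<forall>q\<in>types x M. \<Psi> \<subseteq> q \<longrightarrow> q \<in> B)" by blast
      then show ?case by (intro exI[of _ "\<Phi> \<union> \<Psi>"]) auto
    next
      case (UN K)
      then obtain A where A: "A \<in> K" "p \<in> A" by (auto simp only: Union_iff)
      from UN.IH[OF this] obtain \<Phi>
        where "finite \<Phi>" "\<Phi> \<subseteq> p" "\<forall>q\<in>types x M. \<Phi> \<subseteq> q \<longrightarrow> q \<in> A"
        by (elim exE conjE)
      with A(1) show ?case by (intro exI[of _ \<Phi>]) auto
    next
      case (Basis S)
      then obtain \<phi> where "S = {p \<in> types x M. \<phi> \<in> p}" by blast
      with Basis show ?case by (intro exI[of _ "{\<phi>}"]) auto
    qed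
    show "p \<in> (type_space x M) closure_of (tp x M ` universe M)"
      unfolding in_closure_of topspace_type_space
    proof (intro conjI allI impI p)
      fix U assume U: "p \<in> U \<and> openin (type_space x M) U"
      then obtain \<Phi> where \<Phi>: "finite \<Phi>" "\<Phi> \<subseteq> p" "\<forall>q\<in>types x M. \<Phi> \<subseteq> q \<longrightarrow> q \<in> U"
        using key[of U] unfolding type_space_def openin_topology_generated_by_iff by blast
      from types_inter_tp[OF p \<Phi>(1,2)] obtain a where a: "a \<in> universe M" "\<Phi> \<subseteq> tp x M a" .
      with \<Phi>(3) tp_in_types[OF a(1)] have "tp x M a \<in> U" by simp
      with a(1) show "\<exists>q. q \<in> tp x M ` universe M \<and> q \<in> U" by blast
    qed
  qed
qed

theorem defining_fun_unique:
  assumes "defining_fun x y \<phi> M \<nu> F" "defining_fun x y \<phi> M \<nu> G"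
  shows "F = G"
proof (rule extensionalityI)
  show "F \<in> extensional (types y M)" "G \<in> extensional (types y M)"
    using assms by (simp_all add: defining_fun_def)
  fix p assume "p \<in> types y M"
  then have "p \<in> (type_space y M) closure_of (tp y M ` universe M)"
    by (simp add: closure_of_realised_types)
  moreover have "Hausdorff_space (top_of_set {0..1::real})"
    by (simp add: Hausdorff_space_subtopology)
  moreover have "continuous_map (type_space y M) (top_of_set {0..1}) F"
      "continuous_map (type_space y M) (top_of_set {0..1}) G"
    using assms unfolding defining_fun_def by simp_all
  ultimately show "F p = G p"
  proof (rule forall_in_closure_of_eq)
    fix q assume "q \<in> tp y M ` universe M"
    then show "F q = G q" using assms unfolding defining_fun_def by auto
  qed
qed

lemma the_defining_fun_eq:
  "defining_fun x y \<phi> M \<nu> F \<Longrightarrow> the_defining_fun x y \<phi> M \<nu> = F"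
  unfolding the_defining_fun_def using defining_fun_unique by blast

end

theory Submission
  imports Defs
begin

text \<open>
  Everything rests on one double count.  In the Paley graph on \<open>q\<close> vertices every vertex \<open>a\<close> is
  joined to exactly \<open>(q - 1)/2\<close> vertices, because the differences that count are the non-zero squares.
  Applied to the neighbours of a parameter \<open>b\<close>, this says that the counting measure gives
  \<open>R(x,b)\<close> the value \<open>(q - 1)/(2q)\<close>, and since \<open>q\<close> tends to infinity along a non-principal
  ultrafilter (there are infinitely many primes congruent to 1 modulo 4), the ultralimit gives
  \<open>R(x,b)\<close> the value \<open>1/2\<close> for every \<open>b\<close>.  The constant function is continuous, which is (1).

  Applied instead to the neighbours of the points \<open>a\<close> that carry a finitely supported measure \<open>\<nu>\<close>,
  it says that the average of \<open>\<nu>(R(x,b))\<close> over all \<open>b\<close> is again \<open>(q - 1)/(2q)\<close>, no matter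
  which weights \<open>\<nu>\<close> uses (lemma \<open>conv_measure_edge_sum\<close>).  So some \<open>b\<close> has measure at most
  this average and some \<open>b'\<close> has measure at least this average.  Choosing such a \<open>b\<close> in each
  factor produces elements of the ultraproduct at which a pseudo-finite measure is at most, and at
  least, \<open>1/2\<close>.  If the measure of \<open>R(x,b)\<close> is to be independent of \<open>b\<close>, then it must be
  \<open>1/2\<close> (lemma \<open>pseudofinite_constant_edge_measure\<close>).  This gives both parts of (2): unfair
  coin-flipping measures are constant on the formulas \<open>R(x,b)\<close> too.
\<close>

section \<open>Infinitely many primes congruent to 1 modulo 4\<close>

text \<open>If \<open>p = 4k + 3\<close> divided \<open>a\<^sup>2 + 1\<close>, then Fermat's theorem would give
  \<open>1 = a\<^bsup>p-1\<^esup> = (a\<^sup>2)\<^bsup>2k+1\<^esup> = -1\<close> modulo \<open>p\<close>.\<close>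

lemma odd_prime_dvd_square_plus_one:
  fixes p a :: nat
  assumes p: "prime p" "p \<noteq> 2" and dvd: "p dvd a\<^sup>2 + 1"
  shows "[p = 1] (mod 4)"
proof (rule ccontr)
  assume "\<not> [p = 1] (mod 4)"
  moreover have "odd p" using p by (metis prime_odd_nat prime_ge_2_nat le_neq_implies_less)
  ultimately have "p mod 4 = 3" unfolding cong_def by presburger
  define k where "k = p div 4"
  have pk: "p - 1 = 2 * (2 * k + 1)" using \<open>p mod 4 = 3\<close> unfolding k_def by presburger
  have "\<not> p dvd a"
  proof
    assume "p dvd a"
    then have "p dvd a\<^sup>2" by (simp add: power2_eq_square)
    with dvd have "p dvd 1" using dvd_add_right_iff by blast
    with p(1) show False by (simp add: prime_nat_iff)
  qed
  then have "[a ^ (p - 1) = 1] (mod p)" using p(1) by (rule fermat_theorem[rotated])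
  then have "[int a ^ (p - 1) = 1] (mod int p)"
    by (metis cong_int_iff of_nat_1 of_nat_power)
  moreover have "int p dvd (int a)\<^sup>2 + 1"
    using dvd by (metis of_nat_1 of_nat_add of_nat_dvd_iff of_nat_power)
  then have "[(int a)\<^sup>2 = - 1] (mod int p)" by (simp add: cong_iff_dvd_diff)
  then have "[((int a)\<^sup>2) ^ (2 * k + 1) = (- 1) ^ (2 * k + 1)] (mod int p)" by (rule cong_pow)
  then have "[int a ^ (p - 1) = - 1] (mod int p)" unfolding pk power_mult by simp
  ultimately have "[1 = - 1 :: int] (mod int p)" by (metis cong_sym cong_trans)
  then have "int p dvd 2" by (simp add: cong_iff_dvd_diff)
  then have "p dvd 2" by (metis of_nat_dvd_iff of_nat_numeral)
  with p show False using primes_dvd_imp_eq two_is_prime_nat by blast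
qed

text \<open>A prime divisor of \<open>(n!)\<^sup>2 + 1\<close> exceeds \<open>n\<close> and has \<open>-1\<close> as a square.\<close>

lemma infinite_primes_1_mod_4: "infinite {q::nat. prime q \<and> [q = 1] (mod 4)}"
  unfolding infinite_nat_iff_unbounded
proof
  fix m :: nat
  \<comment> \<open>The summand 2 keeps the prime divisor found below different from 2.\<close>
  define n where "n = m + 2"
  obtain p where p: "prime p" "p dvd (fact n)\<^sup>2 + (1::nat)"
    using prime_factor_nat[of "(fact n)\<^sup>2 + 1"] by auto
  have "\<not> p \<le> n"
  proof
    assume "p \<le> n"
    then have "p dvd (fact n)\<^sup>2"
      using p(1) by (simp add: prime_dvd_fact_iff prime_dvd_power_iff)
    with p(2) have "p dvd 1" using dvd_add_right_iff by blast
    with p(1) show False by (simp add: prime_nat_iff)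
  qed
  with odd_prime_dvd_square_plus_one[OF p(1) _ p(2)] p(1)
  show "\<exists>q>m. q \<in> {q. prime q \<and> [q = 1] (mod 4)}" unfolding n_def by (intro exI[of _ p]) auto
qed

lemma paley_prime: "prime (paley_prime i)" "odd (paley_prime i)" and le_paley_prime: "i \<le> paley_prime i"
proof -
  have "paley_prime i \<in> {q. prime q \<and> [q = 1] (mod 4)}"
    unfolding paley_prime_def using infinite_primes_1_mod_4 by (rule enumerate_in_set)
  then show "prime (paley_prime i)" by simp
  have "paley_prime i mod 4 = 1"
    using \<open>paley_prime i \<in> _\<close> by (simp add: cong_def)
  then show "odd (paley_prime i)" by presburger
  show "i \<le> paley_prime i"
    unfolding paley_prime_def using infinite_primes_1_mod_4 by (rule le_enumerate)
qed


section \<open>Degrees in the Paley graph\<close>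

lemma universe_paley: "universe (paley q) = {0..<int q}"
  by (auto simp: paley_def Let_def residue_ring_def)

definition nonzero_squares :: "nat \<Rightarrow> int set" where
  "nonzero_squares q = {s \<in> {0..<int q}. s \<noteq> 0 \<and> (\<exists>z. z\<^sup>2 mod int q = s)}"

lemma edge_paley_iff:
  assumes q: "1 < q" and ab: "a \<in> universe (paley q)" "b \<in> universe (paley q)"
  shows "edge (paley q) a b \<longleftrightarrow> (a - b) mod int q \<in> nonzero_squares q"
proof -
  interpret residues "int q" "residue_ring (int q)" by unfold_locales (use q in simp_all)
  let ?F = "residue_ring (int q)"
  have car: "carrier ?F = {0..<int q}" by (auto simp: res_carrier_eq)
  have sq: "z [^]\<^bsub>?F\<^esub> (2::nat) = z\<^sup>2 mod int q" if "z \<in> carrier ?F" for z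
    using pow_cong[of z 2] that by (simp add: car)
  have diff: "a \<ominus>\<^bsub>?F\<^esub> b = (a - b) mod int q"
    by (simp add: a_minus_def res_add_eq res_neg_eq mod_simps)
  have "a \<noteq> b \<longleftrightarrow> (a - b) mod int q \<noteq> 0"
    using ab by (auto simp: universe_paley mod_eq_0_iff_dvd dest: zdvd_imp_le mod_eq_dvd_iff[THEN iffD2])
  moreover have "(\<exists>z\<in>carrier ?F. z\<^sup>2 mod int q = s) \<longleftrightarrow> (\<exists>z. z\<^sup>2 mod int q = s)" for s
    using q by (metis mod_in_carrier power_mod)
  ultimately show ?thesis
    using q by (simp add: paley_def Let_def nonzero_squares_def diff sq cong: bex_cong)
qed

text \<open>Each non-zero square has exactly two roots \<open>\<plusminus>z\<close>, one of which lies in the lower half of the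
  residues.\<close>

lemma card_nonzero_squares:
  assumes q: "prime q" "odd q"
  shows "card (nonzero_squares q) = (q - 1) div 2"
proof -
  define h where "h = (int q - 1) div 2"
  have qh: "int q = 2 * h + 1" using q(2) unfolding h_def by presburger
  have pr: "prime (int q)" using q(1) by simp
  have "bij_betw (\<lambda>z. z\<^sup>2 mod int q) {1..h} (nonzero_squares q)"
    unfolding bij_betw_def
  proof
    show "inj_on (\<lambda>z. z\<^sup>2 mod int q) {1..h}"
    proof (rule inj_onI)
      fix z w assume zw: "z \<in> {1..h}" "w \<in> {1..h}" "z\<^sup>2 mod int q = w\<^sup>2 mod int q"
      then have "int q dvd (z - w) * (z + w)"
        by (simp add: mod_eq_dvd_iff power2_eq_square algebra_simps)
      then have "int q dvd z - w \<or> int q dvd z + w" using pr by (simp add: prime_dvd_mult_iff)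
      moreover have "\<not> int q dvd z + w" using zw qh zdvd_imp_le[of "int q" "z + w"] by auto
      moreover have "\<bar>z - w\<bar> < int q" using zw qh by auto
      ultimately show "z = w" using dvd_imp_le_int[of "z - w" "int q"] by fastforce
    qed
    show "(\<lambda>z. z\<^sup>2 mod int q) ` {1..h} = nonzero_squares q"
    proof (intro equalityI subsetI)
      fix s assume "s \<in> (\<lambda>z. z\<^sup>2 mod int q) ` {1..h}"
      then obtain z where z: "z \<in> {1..h}" "s = z\<^sup>2 mod int q" by blast
      have "\<not> int q dvd z" using z(1) qh zdvd_imp_le[of "int q" z] by auto
      then have "s \<noteq> 0" using z(2) pr by (simp add: mod_eq_0_iff_dvd prime_dvd_power_iff)
      moreover have "0 \<le> s" "s < int q" unfolding z(2) using q(1) by (simp_all add: prime_gt_0_nat)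
      ultimately show "s \<in> nonzero_squares q" using z(2) by (auto simp: nonzero_squares_def)
    next
      fix s assume "s \<in> nonzero_squares q"
      then obtain w where w: "s \<noteq> 0" "w\<^sup>2 mod int q = s" by (auto simp: nonzero_squares_def)
      define v where "v = w mod int q"
      have v: "v\<^sup>2 mod int q = s" unfolding v_def using w(2) by (simp add: power_mod)
      have "v \<noteq> 0" using v w(1) by auto
      moreover have "0 \<le> v" "v < int q" unfolding v_def using q(1) by (simp_all add: prime_gt_0_nat)
      ultimately have "v \<in> {1..h} \<or> int q - v \<in> {1..h}" using qh by auto
      moreover have "(int q - v)\<^sup>2 mod int q = s"
        by (metis v power_mod minus_mod_self1 power2_minus)
      ultimately show "s \<in> (\<lambda>z. z\<^sup>2 mod int q) ` {1..h}"
        using v image_eqI[of s "\<lambda>z. z\<^sup>2 mod int q"] by metis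
    qed
  qed
  then have "card (nonzero_squares q) = card {1..h}" by (rule bij_betw_same_card[symmetric])
  then show ?thesis using qh by simp
qed

text \<open>The reflection \<open>b \<mapsto> a - b\<close> carries the out-neighbours of \<open>a\<close>, and the translation
  \<open>a \<mapsto> a - b\<close> the in-neighbours of \<open>b\<close>, onto the non-zero squares.  The counting measure of
  \<open>R(x,b)\<close> is an in-degree, whereas averaging a finitely supported measure over \<open>b\<close> produces
  out-degrees.\<close>

lemma card_paley_out_neighbours:
  assumes q: "prime q" "odd q" and a: "a \<in> universe (paley q)"
  shows "card {b \<in> universe (paley q). edge (paley q) a b} = (q - 1) div 2"
proof -
  have q1: "1 < q" using q(1) by (rule prime_gt_1_nat)
  have "bij_betw (\<lambda>b. (a - b) mod int q)
      {b \<in> universe (paley q). (a - b) mod int q \<in> nonzero_squares q} (nonzero_squares q)"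
      (is "bij_betw _ ?N _")
  proof (rule bij_betw_byWitness[where f' = "\<lambda>s. (a - s) mod int q"])
    have inverse_on_squares: "(a - (a - s) mod int q) mod int q = s" if "s \<in> nonzero_squares q" for s
      using that by (simp add: mod_simps nonzero_squares_def)
    show "\<forall>b\<in>?N. (a - (a - b) mod int q) mod int q = b"
      by (simp add: mod_simps universe_paley)
    show "\<forall>s\<in>nonzero_squares q. (a - (a - s) mod int q) mod int q = s"
      using inverse_on_squares by blast
    show "(\<lambda>b. (a - b) mod int q) ` ?N \<subseteq> nonzero_squares q" by blast
    show "(\<lambda>s. (a - s) mod int q) ` nonzero_squares q \<subseteq> ?N"
      using inverse_on_squares q1 by (auto simp only: universe_paley image_subset_iff mem_Collect_eq atLeastLessThan_iff
          pos_mod_sign pos_mod_bound of_nat_0_less_iff)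
  qed
  moreover have "{b \<in> universe (paley q). edge (paley q) a b}
      = {b \<in> universe (paley q). (a - b) mod int q \<in> nonzero_squares q}"
    using edge_paley_iff[OF q1] a by blast
  ultimately show ?thesis using card_nonzero_squares[OF q] by (simp add: bij_betw_same_card)
qed

lemma card_paley_in_neighbours:
  assumes q: "prime q" "odd q" and b: "b \<in> universe (paley q)"
  shows "card {a \<in> universe (paley q). edge (paley q) a b} = (q - 1) div 2"
proof -
  have q1: "1 < q" using q(1) by (rule prime_gt_1_nat)
  have "bij_betw (\<lambda>a. (a - b) mod int q)
      {a \<in> universe (paley q). (a - b) mod int q \<in> nonzero_squares q} (nonzero_squares q)"
      (is "bij_betw _ ?N _")
  proof (rule bij_betw_byWitness[where f' = "\<lambda>s. (s + b) mod int q"])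
    have inverse_on_squares: "((s + b) mod int q - b) mod int q = s" if "s \<in> nonzero_squares q" for s
      using that by (simp add: mod_simps nonzero_squares_def)
    show "\<forall>a\<in>?N. ((a - b) mod int q + b) mod int q = a"
      by (simp add: mod_simps universe_paley)
    show "\<forall>s\<in>nonzero_squares q. ((s + b) mod int q - b) mod int q = s"
      using inverse_on_squares by blast
    show "(\<lambda>a. (a - b) mod int q) ` ?N \<subseteq> nonzero_squares q" by blast
    show "(\<lambda>s. (s + b) mod int q) ` nonzero_squares q \<subseteq> ?N"
      using inverse_on_squares q1 by (auto simp only: universe_paley image_subset_iff mem_Collect_eq atLeastLessThan_iff
          pos_mod_sign pos_mod_bound of_nat_0_less_iff)
  qed
  moreover have "{a \<in> universe (paley q). edge (paley q) a b}
      = {a \<in> universe (paley q). (a - b) mod int q \<in> nonzero_squares q}"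
    using edge_paley_iff[OF q1] b by blast
  ultimately show ?thesis using card_nonzero_squares[OF q] by (simp add: bij_betw_same_card)
qed


section \<open>Measures in an ultraproduct\<close>

text \<open>An ultrafilter that contains a singleton \<open>{n}\<close> is principal, so \<open>D\<close> contains the complement of
  every singleton and hence every cofinite set.\<close>

lemma nonprincipal_ultrafilter_le_sequentially:
  fixes D :: "nat filter"
  assumes "nonprincipal_ultrafilter D"
  shows "D \<le> sequentially"
  unfolding cofinite_eq_sequentially[symmetric]
proof (rule filter_leI)
  fix P :: "nat \<Rightarrow> bool" assume "eventually P cofinite"
  then have fin: "finite {i. \<not> P i}" by (simp add: eventually_cofinite)
  have D: "ultrafilter D" and np: "D \<noteq> principal {n}" for n
    using assms by (auto simp: nonprincipal_ultrafilter_def)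
  have "eventually (\<lambda>i. i \<noteq> n) D" for n
  proof (rule ccontr)
    assume "\<not> eventually (\<lambda>i. i \<noteq> n) D"
    then have n: "eventually (\<lambda>i. i = n) D" using ultrafilter_not_iff[OF D, of "\<lambda>i. i \<noteq> n"] by simp
    have "eventually Q D \<longleftrightarrow> Q n" for Q
    proof
      assume "eventually Q D"
      with n have "eventually (\<lambda>i. Q n) D" by eventually_elim simp
      then show "Q n" using D by (cases "Q n") (auto simp: ultrafilter_def eventually_False)
    next
      assume "Q n" with n show "eventually Q D" by (auto elim: eventually_mono)
    qed
    then have "D = principal {n}" by (simp add: filter_eq_iff eventually_principal)
    with np show False by blast
  qed
  then have "eventually (\<lambda>i. \<forall>n\<in>{i. \<not> P i}. i \<noteq> n) D"
    using fin by (intro eventually_ball_finite) auto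
  then show "eventually P D" by (rule eventually_mono) blast
qed

lemma ultraproduct_class:
  assumes "\<And>i. f i \<in> universe (M i)"
  obtains A where "A \<in> universe (ultraproduct D M)" "f \<in> A"
proof
  show "eq_mod D M `` {f} \<in> universe (ultraproduct D M)"
    unfolding universe_ultraproduct using assms by (intro quotientI) auto
  show "f \<in> eq_mod D M `` {f}" using assms by (simp add: eq_mod_def)
qed

lemma Rel_in_formulas [simp]: "Rel (Var x) (Par b) \<in> formulas x M \<longleftrightarrow> b \<in> universe M"
  by (auto simp: formulas_def)

lemma tendsto_ultralimit_edge:
  assumes "ultrafilter D" "\<And>i. \<mu> i \<in> keisler_measures x (M i)"
      and "A \<in> universe (ultraproduct D M)" "f \<in> A"
  shows "((\<lambda>i. \<mu> i (Rel (Var x) (Par (f i)))) \<longlongrightarrow> ultralimit x D M \<mu> (Rel (Var x) (Par A))) D"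
  using tendsto_ultralimit[where \<mu> = \<mu> and \<phi> = "Rel (Var x) (Par A)" and \<rho> = "\<lambda>_. f", OF assms(1,2)]
    assms(3,4) by simp

text \<open>Exchanging the two sums turns the sum over parameters into the mean out-degree of the support,
  so that the weights drop out when all out-degrees agree.\<close>

lemma conv_measure_edge_sum:
  assumes \<nu>: "\<nu> \<in> conv_measures x M" and fin: "finite (universe M)"
      and deg: "\<And>a. a \<in> universe M \<Longrightarrow> card {b \<in> universe M. edge M a b} = d"
  shows "(\<Sum>b\<in>universe M. \<nu> (Rel (Var x) (Par b))) = real d"
proof -
  obtain n :: nat and a r where \<nu>:
    "\<nu> = restrict (\<lambda>\<phi>. \<Sum>i<n. r i * dirac x M (tp x M (a i)) \<phi>) (formulas x M)"
    and a: "\<forall>i<n. a i \<in> universe M" and r: "(\<Sum>i<n. r i) = 1"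
    using \<nu> unfolding conv_measures_def by blast
  have "(\<Sum>b\<in>universe M. \<nu> (Rel (Var x) (Par b)))
      = (\<Sum>b\<in>universe M. \<Sum>i<n. r i * of_bool (edge M (a i) b))"
    by (intro sum.cong refl) (simp add: \<nu> dirac_def tp_def of_bool_def)
  also have "\<dots> = (\<Sum>i<n. r i * (\<Sum>b\<in>universe M. of_bool (edge M (a i) b)))"
    by (subst sum.swap) (simp add: sum_distrib_left)
  also have "\<dots> = (\<Sum>i<n. r i * real d)"
    using a fin deg by (intro sum.cong) (auto simp: sum_of_bool_eq Int_def)
  also have "\<dots> = real d" using r by (simp add: sum_distrib_right[symmetric])
  finally show ?thesis .
qed

lemma exists_le_and_ge_average:
  fixes f :: "'a \<Rightarrow> real"
  assumes "finite U" "U \<noteq> {}"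
  shows "\<exists>u\<in>U. f u \<le> sum f U / real (card U)" "\<exists>u\<in>U. sum f U / real (card U) \<le> f u"
proof -
  let ?m = "sum f U / real (card U)"
  have m: "(\<Sum>u\<in>U. ?m) = sum f U" using assms by simp
  show "\<exists>u\<in>U. f u \<le> ?m"
  proof (rule ccontr)
    assume "\<not> ?thesis"
    then have "(\<Sum>u\<in>U. ?m) < sum f U" using assms by (intro sum_strict_mono) auto
    with m show False by simp
  qed
  show "\<exists>u\<in>U. ?m \<le> f u"
  proof (rule ccontr)
    assume "\<not> ?thesis"
    then have "sum f U < (\<Sum>u\<in>U. ?m)" using assms by (intro sum_strict_mono) auto
    with m show False by simp
  qed
qed

text \<open>Choosing a parameter of at most average measure in every factor gives \<open>c \<le> \<delta>\<close>, and one of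
  at least average measure gives \<open>\<delta> \<le> c\<close>.\<close>

lemma pseudofinite_constant_edge_measure:
  fixes M :: "'i \<Rightarrow> 'm relstruct"
  assumes D: "ultrafilter D"
      and fin: "\<And>i. finite (universe (M i))" and ne: "\<And>i. universe (M i) \<noteq> {}"
      and deg: "\<And>i a. a \<in> universe (M i) \<Longrightarrow> card {b \<in> universe (M i). edge (M i) a b} = d i"
      and lim: "((\<lambda>i. real (d i) / real (card (universe (M i)))) \<longlongrightarrow> \<delta>) D"
      and pf: "pseudofinite x D M \<nu>"
      and const: "\<And>b. b \<in> universe (ultraproduct D M) \<Longrightarrow> \<nu> (Rel (Var x) (Par b)) = c"
  shows "c = \<delta>"
proof -
  have nb: "D \<noteq> bot" using D by (simp add: ultrafilter_def)
  obtain \<nu>' where conv: "\<And>i. \<nu>' i \<in> conv_measures x (M i)" and \<nu>: "\<nu> = ultralimit x D M \<nu>'"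
    using pf unfolding pseudofinite_def by blast
  then have keis: "\<And>i. \<nu>' i \<in> keisler_measures x (M i)" using conv_measures_keisler by blast
  have sum: "(\<Sum>b\<in>universe (M i). \<nu>' i (Rel (Var x) (Par b))) = real (d i)" for i
    by (rule conv_measure_edge_sum[OF conv fin deg])
  have to_c: "((\<lambda>i. \<nu>' i (Rel (Var x) (Par (f i)))) \<longlongrightarrow> c) D"
    if f: "\<And>i. f i \<in> universe (M i)" for f
  proof -
    obtain A where A: "A \<in> universe (ultraproduct D M)" "f \<in> A" using ultraproduct_class[OF f] .
    with tendsto_ultralimit_edge[where \<mu> = \<nu>', OF D keis A] const[OF A(1)] \<nu> show ?thesis by simp
  qed
  have average: "\<exists>b\<in>universe (M i). \<nu>' i (Rel (Var x) (Par b)) \<le> real (d i) / real (card (universe (M i)))"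
    "\<exists>b\<in>universe (M i). real (d i) / real (card (universe (M i))) \<le> \<nu>' i (Rel (Var x) (Par b))" for i
    using exists_le_and_ge_average[OF fin[of i] ne[of i], of "\<lambda>b. \<nu>' i (Rel (Var x) (Par b))"]
    unfolding sum by blast+
  have "\<forall>i. \<exists>b. b \<in> universe (M i)
      \<and> \<nu>' i (Rel (Var x) (Par b)) \<le> real (d i) / real (card (universe (M i)))"
    using average(1) by blast
  from choice[OF this] obtain f where f: "\<And>i. f i \<in> universe (M i)"
    "\<And>i. \<nu>' i (Rel (Var x) (Par (f i))) \<le> real (d i) / real (card (universe (M i)))"
    by blast
  have "\<forall>i. \<exists>b. b \<in> universe (M i)
      \<and> real (d i) / real (card (universe (M i))) \<le> \<nu>' i (Rel (Var x) (Par b))"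
    using average(2) by blast
  from choice[OF this] obtain g where g: "\<And>i. g i \<in> universe (M i)"
    "\<And>i. real (d i) / real (card (universe (M i))) \<le> \<nu>' i (Rel (Var x) (Par (g i)))"
    by blast
  have "c \<le> \<delta>" by (rule tendsto_le[OF nb lim to_c[of f]]) (simp_all add: f)
  moreover have "\<delta> \<le> c" by (rule tendsto_le[OF nb to_c[of g] lim]) (simp_all add: g)
  ultimately show ?thesis by simp
qed

lemma ultralimit_counting_measure_edge:
  assumes D: "ultrafilter D"
      and fin: "\<And>i. finite (universe (M i))" and ne: "\<And>i. universe (M i) \<noteq> {}"
      and deg: "\<And>i b. b \<in> universe (M i) \<Longrightarrow> card {a \<in> universe (M i). edge (M i) a b} = d i"
      and lim: "((\<lambda>i. real (d i) / real (card (universe (M i)))) \<longlongrightarrow> \<delta>) D"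
      and A: "A \<in> universe (ultraproduct D M)"
  shows "ultralimit x D M (\<lambda>i. counting_measure x (M i)) (Rel (Var x) (Par A)) = \<delta>"
proof -
  have r: "repr A i \<in> universe (M i)" for i by (rule ultraproduct_memD[OF A repr_mem[OF A]])
  have "((\<lambda>i. counting_measure x (M i) (Rel (Var x) (Par (repr A i))))
      \<longlongrightarrow> ultralimit x D M (\<lambda>i. counting_measure x (M i)) (Rel (Var x) (Par A))) D"
    by (rule tendsto_ultralimit_edge[where \<mu> = "\<lambda>i. counting_measure x (M i)",
          OF D counting_measure_keisler[OF fin ne] A repr_mem[OF A]])
  moreover have "counting_measure x (M i) (Rel (Var x) (Par (repr A i)))
      = real (d i) / real (card (universe (M i)))" for i
    using r[of i] by (simp add: counting_measure_def deg)
  ultimately show ?thesis using lim D tendsto_unique unfolding ultrafilter_def by fastforce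
qed

lemma defining_fun_const:
  assumes "c \<in> {0..1}" and "\<And>b. b \<in> universe M \<Longrightarrow> \<nu> (subst y b \<phi>) = c"
  shows "defining_fun x y \<phi> M \<nu> (restrict (\<lambda>_. c) (types y M))"
proof -
  have "continuous_map (type_space y M) (top_of_set {0..1}) (\<lambda>_. c)"
    using assms(1) by simp
  then have "continuous_map (type_space y M) (top_of_set {0..1}) (restrict (\<lambda>_. c) (types y M))"
    by (rule continuous_map_eq) (simp add: topspace_type_space)
  then show ?thesis using assms(2) tp_in_types[of _ M y] by (auto simp: defining_fun_def)
qed

text \<open>This is the defining condition for one positive and no negative literal.\<close>

lemma unfair_coin_flipping_edge:
  assumes "unfair_coin_flipping_measure x M r \<nu>" "b \<in> universe M"
  shows "\<nu> (Rel (Var x) (Par b)) = r"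
proof -
  let ?\<phi> = "Conj (Conjs (map (\<lambda>a. Rel (Var x) (Par a)) [b])) (Conjs (map (\<lambda>b. Neg (Rel (Var x) (Par b))) []))"
  have \<nu>: "\<nu> \<in> keisler_measures x M"
    using assms(1) by (simp add: unfair_coin_flipping_measure_def)
  have "distinct ([b] @ []) \<and> set ([b] @ []) \<subseteq> universe M" using assms(2) by simp
  then have eq: "\<nu> ?\<phi> = r ^ length [b] * (1 - r) ^ length ([] :: 'a list)"
    using assms(1) unfolding unfair_coin_flipping_measure_def by blast
  have "\<nu> (Rel (Var x) (Par b)) = \<nu> ?\<phi>"
    by (rule keisler_measures_cong[OF \<nu>]) (use assms(2) in \<open>auto simp: Conjs_def formulas_def\<close>)
  with eq show ?thesis by simp
qed


section \<open>Pseudo-finite measures over an ultraproduct of Paley graphs\<close>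

lemma paley_density_tendsto:
  "((\<lambda>i. real ((paley_prime i - 1) div 2) / real (card (universe (paley (paley_prime i))))) \<longlongrightarrow> 1 / 2)
     sequentially"
proof -
  let ?q = "\<lambda>i. real (paley_prime i)"
  have "filterlim ?q at_top sequentially"
    by (rule filterlim_at_top_mono[OF filterlim_real_sequentially]) (simp add: le_paley_prime)
  then have "((\<lambda>i. 1 / 2 - inverse (?q i) / 2) \<longlongrightarrow> 1 / 2 - 0 / 2) sequentially"
    by (intro tendsto_intros tendsto_inverse_0_at_top) auto
  moreover have "real ((paley_prime i - 1) div 2) / real (card (universe (paley (paley_prime i))))
      = 1 / 2 - inverse (?q i) / 2" for i
  proof -
    obtain k where k: "paley_prime i = 2 * k + 1" using paley_prime(2) by (rule oddE)
    show ?thesis unfolding universe_paley k by (simp add: field_simps)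
  qed
  ultimately show ?thesis by simp
qed

theorem theorem4p14:
  fixes D :: "nat filter" and x y :: nat
    and \<M> :: "(nat \<Rightarrow> int) set relstruct"
    and \<mu> :: "(nat \<Rightarrow> int) set fm \<Rightarrow> real"
  assumes "nonprincipal_ultrafilter D" and "x \<noteq> y"
    and "\<M> = ultraproduct D (\<lambda>i. paley (paley_prime i))"
    and "\<mu> = ultralimit x D (\<lambda>i. paley (paley_prime i)) (\<lambda>i. counting_measure x (paley (paley_prime i)))"
  shows "(definable_for x y (Rel (Var x) (Var y)) \<M> \<mu>
          \<and> (\<forall>p\<in>types y \<M>. the_defining_fun x y (Rel (Var x) (Var y)) \<M> \<mu> p = 1/2))
       \<and> (\<forall>\<nu>\<in>keisler_measures x \<M>.
            definable_for x y (Rel (Var x) (Var y)) \<M> \<nu>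
            \<and> (\<exists>c. c \<noteq> 1/2
                 \<and> (\<forall>p\<in>types y \<M>. the_defining_fun x y (Rel (Var x) (Var y)) \<M> \<nu> p = c))
            \<longrightarrow> \<not> pseudofinite x D (\<lambda>i. paley (paley_prime i)) \<nu>)
       \<and> (\<forall>r \<nu>. unfair_coin_flipping_measure x \<M> r \<nu>
            \<longrightarrow> \<not> pseudofinite x D (\<lambda>i. paley (paley_prime i)) \<nu>)"
proof -
  let ?M = "\<lambda>i. paley (paley_prime i)" and ?R = "Rel (Var x) (Var y) :: (nat \<Rightarrow> int) set fm"
  note \<M> = assms(3) and \<mu> = assms(4)
  have D: "ultrafilter D" using assms(1) by (simp add: nonprincipal_ultrafilter_def)
  have fin: "finite (universe (?M i))" and ne: "universe (?M i) \<noteq> {}" for i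
    using prime_gt_0_nat[OF paley_prime(1)[of i]] by (auto simp: universe_paley)
  note density = tendsto_mono[OF nonprincipal_ultrafilter_le_sequentially[OF assms(1)] paley_density_tendsto]
  have subst_R: "subst y b ?R = Rel (Var x) (Par b)" for b using assms(2) by simp
  have "\<mu> (Rel (Var x) (Par b)) = 1/2" if "b \<in> universe \<M>" for b
    unfolding \<mu> by (rule ultralimit_counting_measure_edge[where M = ?M, OF D fin ne
        card_paley_in_neighbours[OF paley_prime] density that[unfolded \<M>]])
  then have F: "defining_fun x y ?R \<M> \<mu> (restrict (\<lambda>_. 1/2) (types y \<M>))"
    by (intro defining_fun_const) (simp_all only: subst_R, simp)
  have half: "c = 1/2" if "pseudofinite x D ?M \<nu>"
    and "\<And>b. b \<in> universe \<M> \<Longrightarrow> \<nu> (Rel (Var x) (Par b)) = c" for \<nu> c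
    by (rule pseudofinite_constant_edge_measure[where M = ?M, OF D fin ne
        card_paley_out_neighbours[OF paley_prime] density that(1) that(2)[unfolded \<M>]])
  show ?thesis
  proof (intro conjI ballI allI impI)
    show "definable_for x y ?R \<M> \<mu>" using F by (auto simp: definable_for_def)
    show "the_defining_fun x y ?R \<M> \<mu> p = 1/2" if "p \<in> types y \<M>" for p
      using the_defining_fun_eq[OF F] that by simp
  next
    fix \<nu>
    assume "definable_for x y ?R \<M> \<nu> \<and> (\<exists>c. c \<noteq> 1/2
        \<and> (\<forall>p\<in>types y \<M>. the_defining_fun x y ?R \<M> \<nu> p = c))"
    then obtain G c where G: "defining_fun x y ?R \<M> \<nu> G" and c: "c \<noteq> 1/2"
      "\<forall>p\<in>types y \<M>. the_defining_fun x y ?R \<M> \<nu> p = c"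
      unfolding definable_for_def by blast
    have "\<nu> (Rel (Var x) (Par b)) = c" if "b \<in> universe \<M>" for b
    proof -
      have "\<nu> (Rel (Var x) (Par b)) = G (tp y \<M> b)"
        using G that subst_R unfolding defining_fun_def by metis
      also have "\<dots> = c" using c(2) tp_in_types[OF that] the_defining_fun_eq[OF G] by blast
      finally show ?thesis .
    qed
    with half c(1) show "\<not> pseudofinite x D ?M \<nu>" by blast
  next
    fix r \<nu> assume coin: "unfair_coin_flipping_measure x \<M> r \<nu>"
    then have "r \<noteq> 1/2" by (simp add: unfair_coin_flipping_measure_def)
    with half unfair_coin_flipping_edge[OF coin] show "\<not> pseudofinite x D ?M \<nu>" by blast
  qed
qed

end
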